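(* Let $v$ be a typical weight on the open unit disk $\mathbb{D}$ and let $(z_n)_{n\in\mathbb{N}}\subset\mathbb{D}$ be a sequence. Suppose that for every $(a_n)\in c_0$ there exists $f\in\mathcal{B}_v^\infty$ such that $v(z_n)f'(z_n)=a_n$ for all $n\in\mathbb{N}$. Then $(z_n)$ is interpolating for $\mathcal{B}_v^\infty$, i.e. for every $(a_n)\in\ell_\infty$ there exists $f\in\mathcal{B}_v^\infty$ such that $v(z_n)f'(z_n)=a_n$ for all $n\in\mathbb{N}$.
   Context: $\mathbb{D}$ is the open unit disk of $\mathbb{C}$ and $H(\mathbb{D})$ is the space of complex analytic functions on $\mathbb{D}$. A weight $v$ is a strictly positive continuous function on $\mathbb{D}$; it is typical if it is radial ($v(z)=v(|z|)$ for all $z\in\mathbb{D}$), non-increasing (in $|z|$), and $\lim_{|z|\to1}v(z)=0$. The Bloch type space is $$\mathcal{B}_v^\infty=\{f\in H(\mathbb{D}):\ \|f\|_{\mathcal{B}_v^\infty}:=|f(0)|+\sup_{z\in\mathbb{D}}v(z)|f'(z)|<\infty\}.$$ $\ell_\infty$ is the space of bounded complex sequences and $c_0$ the subspace of sequences converging to $0$. *)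

theory Defs
  imports "HOL-Analysis.Analysis"
begin

abbreviation unit_disk :: "complex set" where
  "unit_disk \<equiv> ball 0 1"

definition weight :: "(complex \<Rightarrow> real) \<Rightarrow> bool" where
  "weight v \<longleftrightarrow> continuous_on unit_disk v \<and> (\<forall>z\<in>unit_disk. 0 < v z)"

(* The filter "filtercomap norm (at_left 1)" is generated by the annuli
   r < |z| < 1 with r < 1, so the last conjunct is the limit as |z| tends to 1
   within the disk. *)
definition typical_weight :: "(complex \<Rightarrow> real) \<Rightarrow> bool" where
  "typical_weight v \<longleftrightarrow>
     weight v \<and>
     (\<forall>z\<in>unit_disk. v z = v (of_real (norm z))) \<and>
     (\<forall>z\<in>unit_disk. \<forall>w\<in>unit_disk. norm z \<le> norm w \<longrightarrow> v w \<le> v z) \<and>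
     (v \<longlongrightarrow> 0) (filtercomap norm (at_left 1))"

(* Valued in the extended reals, so that an infinite norm is really infinite. *)
definition bloch_norm :: "(complex \<Rightarrow> real) \<Rightarrow> (complex \<Rightarrow> complex) \<Rightarrow> ereal" where
  "bloch_norm v f =
     ereal (norm (f 0)) + (SUP z\<in>unit_disk. ereal (v z * norm (deriv f z)))"

(* Functions are total in HOL: an element of the space is represented by any
   function on the plane with the right restriction to the disk. Values outside
   the disk are irrelevant, as the disk is open. *)
definition bloch_space :: "(complex \<Rightarrow> real) \<Rightarrow> (complex \<Rightarrow> complex) set" where
  "bloch_space v = {f. f holomorphic_on unit_disk \<and> bloch_norm v f < \<infinity>}"

definition ell_infinity :: "(nat \<Rightarrow> complex) set" where
  "ell_infinity = {a. Bseq a}"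

definition c_zero :: "(nat \<Rightarrow> complex) set" where
  "c_zero = {a. a \<longlonglongrightarrow> 0}"

definition interpolating_bloch :: "(complex \<Rightarrow> real) \<Rightarrow> (nat \<Rightarrow> complex) \<Rightarrow> bool" where
  "interpolating_bloch v z \<longleftrightarrow>
     (\<forall>a\<in>ell_infinity. \<exists>f\<in>bloch_space v. \<forall>n. of_real (v (z n)) * deriv f (z n) = a n)"

end

theory Submission
  imports Defs "HOL-Complex_Analysis.Complex_Analysis"
begin

text \<open>
  The problem only involves the derivative \<open>g = f'\<close>, so it is about interpolating by functions of
  the balls \<open>K\<^sub>M = {g holomorphic. v \<bar>g\<bar> \<le> M}\<close>; the disk being convex, every such \<open>g\<close> has a primitive.
  Let \<open>T\<^sub>M\<close> be the set of the sequences \<open>v (z\<^sub>n) g (z\<^sub>n)\<close> with \<open>g \<in> K\<^sub>M\<close>. Everything rests on one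
  compactness property (\<open>weighted_traces_limit\<close>): \<open>T\<^sub>M\<close> is closed under pointwise limits of
  sequences, because \<open>K\<^sub>M\<close> is a normal family by Montel's theorem and is itself closed under
  locally uniform limits.

  This property is used twice. The hypothesis says that \<open>c\<^sub>0\<close> is covered by \<open>T\<^sub>0, T\<^sub>1, T\<^sub>2, \<dots>\<close>. These
  sets are closed, hence by Baire's theorem in the Banach space \<open>c\<^sub>0\<close> one of them contains a ball
  (\<open>c_zero_Baire\<close>), and since \<open>T\<^sub>M - T\<^sub>N \<subseteq> T\<^bsub>M+N\<^esub>\<close>, one of them contains a ball around \<open>0\<close>. This is
  a uniform bound: null sequences bounded by \<open>1\<close> are interpolated within a single \<open>K\<^sub>C\<close>
  (\<open>weighted_traces_uniform\<close>). A bounded sequence, suitably scaled, is the pointwise limit of its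
  truncations, which are null sequences with the same bound, so that it is in \<open>T\<^sub>C\<close> as well.
\<close>

section \<open>Weighted balls of holomorphic functions and their traces\<close>

definition weighted_ball :: "(complex \<Rightarrow> real) \<Rightarrow> real \<Rightarrow> (complex \<Rightarrow> complex) set" where
  "weighted_ball v M =
     {g. g holomorphic_on unit_disk \<and> (\<forall>x\<in>unit_disk. v x * norm (g x) \<le> M)}"

definition weighted_traces ::
    "(complex \<Rightarrow> real) \<Rightarrow> (nat \<Rightarrow> complex) \<Rightarrow> real \<Rightarrow> (nat \<Rightarrow> complex) set" where
  "weighted_traces v z M = {a. \<exists>g\<in>weighted_ball v M. \<forall>n. of_real (v (z n)) * g (z n) = a n}"

lemma weighted_tracesI:
  assumes "g \<in> weighted_ball v M" "\<And>n. of_real (v (z n)) * g (z n) = a n"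
  shows "a \<in> weighted_traces v z M"
  using assms by (auto simp: weighted_traces_def)

lemma deriv_bloch_in_weighted_ball:
  assumes "f \<in> bloch_space v"
  obtains M where "deriv f \<in> weighted_ball v M"
proof -
  have hol: "f holomorphic_on unit_disk" and fin: "bloch_norm v f < \<infinity>"
    using assms by (auto simp: bloch_space_def)
  define S where "S = (SUP x\<in>unit_disk. ereal (v x * norm (deriv f x)))"
  have upper: "ereal (v x * norm (deriv f x)) \<le> S" if "x \<in> unit_disk" for x
    unfolding S_def using that by (rule SUP_upper)
  have "S < \<infinity>"
    using fin unfolding bloch_norm_def S_def[symmetric] by auto
  moreover have "S \<noteq> -\<infinity>"
    using upper[of 0] by auto
  ultimately obtain M where "S = ereal M"
    by (cases S) auto
  hence "deriv f \<in> weighted_ball v M"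
    using upper hol by (auto simp: weighted_ball_def intro!: holomorphic_deriv)
  thus thesis ..
qed

lemma primitive_in_bloch_space:
  assumes "g \<in> weighted_ball v M"
  obtains f where "f \<in> bloch_space v" "\<And>x. x \<in> unit_disk \<Longrightarrow> deriv f x = g x"
proof -
  have "g holomorphic_on unit_disk"
    using assms by (simp add: weighted_ball_def)
  then obtain f where f: "\<And>x. x \<in> unit_disk \<Longrightarrow> (f has_field_derivative g x) (at x within unit_disk)"
    using holomorphic_convex_primitive'[of unit_disk g] by auto
  have deriv: "deriv f x = g x" if "x \<in> unit_disk" for x
    using f[OF that] that by (intro DERIV_imp_deriv) (simp add: at_within_open[OF _ open_ball])
  have "(SUP x\<in>unit_disk. ereal (v x * norm (deriv f x))) \<le> ereal M"
    using assms by (intro SUP_least) (auto simp: deriv weighted_ball_def)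
  hence "(SUP x\<in>unit_disk. ereal (v x * norm (deriv f x))) < \<infinity>"
    by auto
  hence "bloch_norm v f < \<infinity>"
    by (auto simp: bloch_norm_def)
  moreover have "f holomorphic_on unit_disk"
    using f unfolding holomorphic_on_def field_differentiable_def by blast
  ultimately show thesis
    using that[of f] deriv by (simp add: bloch_space_def)
qed

text \<open>
  On a compact subset of the disk \<open>v\<close> is bounded away from \<open>0\<close>, so the weighted ball is locally
  bounded and Montel's theorem gives a subsequence converging to a holomorphic \<open>g\<close>. The weighted bound
  passes to \<open>g\<close> point by point, and so do the values at the \<open>z n\<close>.
\<close>
lemma weighted_traces_limit:
  assumes v: "weight v" and z: "\<And>n. z n \<in> unit_disk"
    and s: "\<And>j. s j \<in> weighted_traces v z M"
    and lim: "\<And>n. (\<lambda>j. s j n) \<longlonglongrightarrow> a n"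
  shows "a \<in> weighted_traces v z M"
proof -
  from s have "\<forall>j. \<exists>g. g \<in> weighted_ball v M \<and> (\<forall>n. of_real (v (z n)) * g (z n) = s j n)"
    by (auto simp: weighted_traces_def)
  then obtain G where G: "\<And>j. G j \<in> weighted_ball v M"
    and Gs: "\<And>j n. of_real (v (z n)) * G j (z n) = s j n"
    by metis
  have bounded: "\<exists>B. \<forall>h\<in>weighted_ball v M. \<forall>x\<in>K. norm (h x) \<le> B"
    if K: "compact K" "K \<subseteq> unit_disk" for K
  proof (cases "K = {}")
    case False
    have "continuous_on K v"
      using v K(2) by (auto simp: weight_def intro: continuous_on_subset)
    then obtain y where y: "y \<in> K" "\<And>x. x \<in> K \<Longrightarrow> v y \<le> v x"
      using continuous_attains_inf[OF K(1) False] by blast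
    have "0 < v y"
      using v y(1) K(2) by (auto simp: weight_def)
    have "norm (h x) \<le> M / v y" if "h \<in> weighted_ball v M" "x \<in> K" for h x
    proof -
      have "v y * norm (h x) \<le> v x * norm (h x)"
        using y(2)[OF that(2)] by (intro mult_right_mono) auto
      also have "\<dots> \<le> M"
        using that K(2) by (auto simp: weighted_ball_def)
      finally show ?thesis
        using \<open>0 < v y\<close> by (simp add: field_simps)
    qed
    thus ?thesis by blast
  qed auto
  obtain g r where g: "g holomorphic_on unit_disk" and r: "strict_mono (r :: nat \<Rightarrow> nat)"
    and Glim: "\<And>x. x \<in> unit_disk \<Longrightarrow> (\<lambda>j. G (r j) x) \<longlonglongrightarrow> g x"
  proof (rule Montel[of unit_disk "weighted_ball v M" G])
    show "range G \<subseteq> weighted_ball v M"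
      using G by auto
  qed (use bounded in \<open>auto simp: weighted_ball_def\<close>)
  have "v x * norm (g x) \<le> M" if "x \<in> unit_disk" for x
  proof (rule LIMSEQ_le_const2)
    show "(\<lambda>j. v x * norm (G (r j) x)) \<longlonglongrightarrow> v x * norm (g x)"
      by (intro tendsto_intros Glim that)
    show "\<exists>N. \<forall>j\<ge>N. v x * norm (G (r j) x) \<le> M"
      using G that by (auto simp: weighted_ball_def)
  qed
  hence "g \<in> weighted_ball v M"
    using g by (simp add: weighted_ball_def)
  moreover have "of_real (v (z n)) * g (z n) = a n" for n
  proof (rule LIMSEQ_unique)
    show "(\<lambda>j. of_real (v (z n)) * G (r j) (z n)) \<longlonglongrightarrow> of_real (v (z n)) * g (z n)"
      by (intro tendsto_intros Glim z)
    show "(\<lambda>j. of_real (v (z n)) * G (r j) (z n)) \<longlonglongrightarrow> a n"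
      using LIMSEQ_subseq_LIMSEQ[OF lim r] by (simp add: Gs o_def)
  qed
  ultimately show ?thesis
    by (rule weighted_tracesI)
qed

lemma weighted_traces_diff:
  assumes v: "weight v"
    and a: "a \<in> weighted_traces v z M" and b: "b \<in> weighted_traces v z N"
  shows "(\<lambda>n. a n - b n) \<in> weighted_traces v z (M + N)"
proof -
  obtain g h where g: "g \<in> weighted_ball v M" "\<And>n. of_real (v (z n)) * g (z n) = a n"
    and h: "h \<in> weighted_ball v N" "\<And>n. of_real (v (z n)) * h (z n) = b n"
    using a b by (auto simp: weighted_traces_def)
  have "v x * norm (g x - h x) \<le> M + N" if x: "x \<in> unit_disk" for x
  proof -
    have "v x * norm (g x - h x) \<le> v x * (norm (g x) + norm (h x))"
      using v x by (intro mult_left_mono norm_triangle_ineq4) (auto simp: weight_def less_imp_le)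
    also have "\<dots> \<le> M + N"
      using g(1) h(1) x by (auto simp: weighted_ball_def distrib_left intro!: add_mono)
    finally show ?thesis .
  qed
  hence "(\<lambda>x. g x - h x) \<in> weighted_ball v (M + N)"
    using g(1) h(1) by (auto simp: weighted_ball_def intro!: holomorphic_intros)
  moreover have "of_real (v (z n)) * (g (z n) - h (z n)) = a n - b n" for n
    using g(2)[of n] h(2)[of n] by (simp add: right_diff_distrib)
  ultimately show ?thesis
    by (rule weighted_tracesI)
qed

lemma weighted_traces_scale:
  assumes "a \<in> weighted_traces v z M" "0 \<le> t"
  shows "(\<lambda>n. of_real t * a n) \<in> weighted_traces v z (t * M)"
proof -
  obtain g where g: "g \<in> weighted_ball v M" "\<And>n. of_real (v (z n)) * g (z n) = a n"
    using assms(1) by (auto simp: weighted_traces_def)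
  have "v x * norm (of_real t * g x) \<le> t * M" if "x \<in> unit_disk" for x
    using g(1) that assms(2) mult_left_mono[of "v x * norm (g x)" M t]
    by (auto simp: weighted_ball_def norm_mult mult_ac)
  hence "(\<lambda>x. of_real t * g x) \<in> weighted_ball v (t * M)"
    using g(1) by (auto simp: weighted_ball_def intro!: holomorphic_intros)
  moreover have "of_real (v (z n)) * (of_real t * g (z n)) = of_real t * a n" for n
    using g(2)[of n] by (metis mult.left_commute)
  ultimately show ?thesis
    by (rule weighted_tracesI)
qed

lemma weighted_traces_mono:
  "M \<le> N \<Longrightarrow> weighted_traces v z M \<subseteq> weighted_traces v z N"
  by (fastforce simp: weighted_traces_def weighted_ball_def)

section \<open>Baire category in the space of null sequences\<close>

text \<open>
  If all the closed sets had empty interior, so would their union by Baire's theorem; but the union is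
  the whole space.
\<close>
lemma (in Metric_space) closed_cover_contains_ball:
  fixes A :: "nat \<Rightarrow> 'a set"
  assumes complete: mcomplete and nonempty: "M \<noteq> {}"
    and closed: "\<And>k. closedin mtopology (A k)" and cover: "M \<subseteq> (\<Union>k. A k)"
  obtains k x e where "x \<in> M" "0 < e" "mball x e \<subseteq> A k"
proof -
  have "\<exists>k. mtopology interior_of (A k) \<noteq> {}"
  proof (rule ccontr)
    assume "\<not> ?thesis"
    hence "mtopology interior_of \<Union>(range A) = {}"
      using closed by (intro metric_Baire_category_alt complete) auto
    moreover have "\<Union>(range A) = M"
      using cover closedin_subset[OF closed] by auto
    ultimately show False
      using nonempty by (metis interior_of_topspace topspace_mtopology)
  qed
  then obtain k x where x: "x \<in> mtopology interior_of (A k)"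
    by blast
  then obtain e where e: "0 < e" "mball x e \<subseteq> mtopology interior_of (A k)"
    using openin_mtopology openin_interior_of by metis
  have "mball x e \<subseteq> A k"
    using e(2) interior_of_subset[of mtopology "A k"] by (rule order_trans)
  moreover have "x \<in> M"
    using x interior_of_subset_topspace[of mtopology "A k"] topspace_mtopology by blast
  ultimately show thesis
    using that[OF _ e(1)] by blast
qed

text \<open>
  The metric on the null sequences is inherited from the complete space of bounded functions from
  \<open>\<nat>\<close> to the plane with the supremum distance.
\<close>
abbreviation (input) bounded_sequences :: "(nat \<Rightarrow> complex) set" where
  "bounded_sequences \<equiv> Metric_space.fspace UNIV dist UNIV"

abbreviation (input) sup_dist :: "(nat \<Rightarrow> complex) \<Rightarrow> (nat \<Rightarrow> complex) \<Rightarrow> real" where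
  "sup_dist \<equiv> Metric_space.fdist UNIV dist UNIV"

interpretation bounded_seq: Metric_space bounded_sequences sup_dist
  by (rule Met_TC.Metric_space_funspace)

lemma bounded_seq_complete: "bounded_seq.mcomplete"
  using Met_TC.mcomplete_funspace[where S = "UNIV :: nat set" and 'a = complex]
  by (simp add: mcomplete_of_def complete_UNIV)

lemma sup_dist_le_iff:
  assumes "f \<in> bounded_sequences" "g \<in> bounded_sequences"
  shows "sup_dist f g \<le> e \<longleftrightarrow> (\<forall>n. dist (f n) (g n) \<le> e)"
  using Met_TC.funspace_mdist_le[OF assms] by simp

lemma null_sequences_bounded: "c_zero \<subseteq> bounded_sequences"
  by (auto simp: c_zero_def Met_TC.fspace_def intro: convergent_imp_bounded)

lemma bounded_seq_limit_uniform:
  assumes "limitin bounded_seq.mtopology s a sequentially"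
  shows "uniform_limit UNIV s a sequentially"
proof (rule uniform_limitI)
  fix e :: real assume "0 < e"
  have a: "a \<in> bounded_sequences"
    using assms by (simp add: bounded_seq.limit_metric_sequentially)
  obtain N where N: "\<And>j. N \<le> j \<Longrightarrow> s j \<in> bounded_sequences \<and> sup_dist (s j) a < e"
    using assms \<open>0 < e\<close> by (metis bounded_seq.limit_metric_sequentially)
  have "\<forall>n\<in>UNIV. dist (s j n) (a n) < e" if "N \<le> j" for j
    using N[OF that] sup_dist_le_iff[OF _ a, of "s j" "sup_dist (s j) a"]
    by (meson le_less_trans order_refl)
  thus "\<forall>\<^sub>F j in sequentially. \<forall>n\<in>UNIV. dist (s j n) (a n) < e"
    by (auto simp: eventually_sequentially)
qed

interpretation null_seq: Submetric bounded_sequences sup_dist c_zero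
  by unfold_locales (rule null_sequences_bounded)

text \<open>
  A uniform limit can be exchanged with the limit at infinity, so the null sequences are closed in the
  complete space of the bounded ones.
\<close>
lemma null_seq_complete: "null_seq.sub.mcomplete"
proof (rule null_seq.sequentially_closedin_mcomplete_imp_mcomplete[OF bounded_seq_complete])
  fix s a assume *: "range s \<subseteq> c_zero \<and> limitin bounded_seq.mtopology s a sequentially"
  hence zero: "s j \<longlonglongrightarrow> 0" for j
    by (auto simp: c_zero_def)
  have "a \<longlonglongrightarrow> 0"
  proof (rule swap_uniform_limit')
    show "\<forall>\<^sub>F j in sequentially. (s j \<longlongrightarrow> 0) sequentially"
      using zero by simp
    show "((\<lambda>_. 0) \<longlongrightarrow> (0 :: complex)) sequentially"
      by simp
    show "uniform_limit UNIV s a sequentially"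
      using * bounded_seq_limit_uniform by blast
  qed auto
  thus "a \<in> c_zero"
    by (simp add: c_zero_def)
qed

text \<open>
  Pointwise convergence is weaker than uniform convergence, so sets closed under pointwise limits
  are closed in \<open>c_zero\<close>. The radius of the ball is halved to pass from open balls of the supremum
  distance to a bound with \<open>\<le>\<close> on every term.
\<close>
lemma c_zero_Baire:
  fixes A :: "nat \<Rightarrow> (nat \<Rightarrow> complex) set"
  assumes closed: "\<And>k s a. (\<And>j. s j \<in> A k) \<Longrightarrow> (\<And>n. (\<lambda>j. s j n) \<longlonglongrightarrow> a n) \<Longrightarrow> a \<in> A k"
    and cover: "c_zero \<subseteq> (\<Union>k. A k)"
  obtains k a e where "a \<in> c_zero" "0 < e"
    "\<And>b. b \<in> c_zero \<Longrightarrow> (\<And>n. norm (b n - a n) \<le> e) \<Longrightarrow> b \<in> A k"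
proof -
  have "closedin null_seq.sub.mtopology (c_zero \<inter> A k)" for k
    unfolding null_seq.sub.metric_closedin_iff_sequentially_closed
  proof (intro conjI allI impI; (elim conjE)?)
    fix s a
    assume s: "range s \<subseteq> c_zero \<inter> A k" and lim: "limitin null_seq.sub.mtopology s a sequentially"
    have lim': "a \<in> c_zero" "limitin bounded_seq.mtopology s a sequentially"
      using lim by (simp_all add: null_seq.limitin_submetric_iff)
    have "(\<lambda>j. s j n) \<longlonglongrightarrow> a n" for n
      using bounded_seq_limit_uniform[OF lim'(2)] by (rule tendsto_uniform_limitI) simp
    moreover have "s j \<in> A k" for j
      using s by blast
    ultimately have "a \<in> A k"
      using closed[of s k a] by blast
    thus "a \<in> c_zero \<inter> A k"
      using lim'(1) by blast
  qed auto
  moreover have "(\<lambda>_. 0) \<in> c_zero"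
    by (simp add: c_zero_def)
  hence "c_zero \<noteq> {}"
    by blast
  moreover have "c_zero \<subseteq> (\<Union>k. c_zero \<inter> A k)"
    using cover by auto
  ultimately obtain k a e where a: "a \<in> c_zero" and e: "0 < e"
    and ball: "null_seq.sub.mball a e \<subseteq> c_zero \<inter> A k"
    using null_seq.sub.closed_cover_contains_ball[OF null_seq_complete, of "\<lambda>k. c_zero \<inter> A k"]
    by metis
  show thesis
  proof (rule that[OF a])
    show "0 < e / 2"
      using e by simp
    fix b assume b: "b \<in> c_zero" "\<And>n. norm (b n - a n) \<le> e / 2"
    have "sup_dist a b \<le> e / 2"
      using a b null_sequences_bounded
      by (subst sup_dist_le_iff) (auto simp: dist_norm norm_minus_commute)
    hence "b \<in> null_seq.sub.mball a e"
      using a b(1) e by simp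
    thus "b \<in> A k"
      using ball by blast
  qed
qed

section \<open>From null sequences to bounded sequences\<close>

text \<open>
  A ball of \<open>c_zero\<close> of radius \<open>e\<close> around some \<open>a\<close> consists of traces from the weighted ball of
  radius \<open>k\<close>; subtracting the trace \<open>a\<close> moves it to the origin at the cost of doubling \<open>k\<close>, and
  dividing by \<open>e\<close> turns it into the unit ball.
\<close>
lemma weighted_traces_uniform:
  assumes v: "weight v" and z: "\<And>n. z n \<in> unit_disk"
    and c0: "\<And>a. a \<in> c_zero \<Longrightarrow> \<exists>M. a \<in> weighted_traces v z M"
  shows "\<exists>C. \<forall>b\<in>c_zero. (\<forall>n. norm (b n) \<le> 1) \<longrightarrow> b \<in> weighted_traces v z C"
proof -
  have cover: "c_zero \<subseteq> (\<Union>k::nat. weighted_traces v z (real k))"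
  proof
    fix a assume "a \<in> c_zero"
    then obtain M where "a \<in> weighted_traces v z M"
      using c0 by blast
    moreover obtain k :: nat where "M \<le> real k"
      using real_arch_simple by blast
    ultimately show "a \<in> (\<Union>k::nat. weighted_traces v z (real k))"
      using weighted_traces_mono by blast
  qed
  obtain k :: nat and a e where a: "a \<in> c_zero" and e: "0 < e"
    and ball: "\<And>b. b \<in> c_zero \<Longrightarrow> (\<And>n. norm (b n - a n) \<le> e) \<Longrightarrow> b \<in> weighted_traces v z (real k)"
  proof (rule c_zero_Baire[of "\<lambda>k. weighted_traces v z (real k)"])
    fix k s a
    assume "\<And>j. s j \<in> weighted_traces v z (real k)" "\<And>n. (\<lambda>j. s j n) \<longlonglongrightarrow> a n"
    thus "a \<in> weighted_traces v z (real k)"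
      by (rule weighted_traces_limit[OF v z])
  qed (use cover in auto)
  have "b \<in> weighted_traces v z (1 / e * (real k + real k))"
    if b: "b \<in> c_zero" "\<And>n. norm (b n) \<le> 1" for b
  proof -
    have "(\<lambda>n. a n + of_real e * b n) \<in> c_zero"
      using a b(1) by (auto simp: c_zero_def intro!: tendsto_eq_intros)
    moreover have "norm ((a n + of_real e * b n) - a n) \<le> e" for n
      using b(2)[of n] e by (simp add: norm_mult)
    ultimately have "(\<lambda>n. a n + of_real e * b n) \<in> weighted_traces v z (real k)"
      by (rule ball)
    moreover have "a \<in> weighted_traces v z (real k)"
      using a e by (intro ball) auto
    ultimately have "(\<lambda>n. (a n + of_real e * b n) - a n) \<in> weighted_traces v z (real k + real k)"
      by (rule weighted_traces_diff[OF v])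
    hence "(\<lambda>n. of_real (1 / e) * ((a n + of_real e * b n) - a n))
             \<in> weighted_traces v z (1 / e * (real k + real k))"
      using e by (intro weighted_traces_scale) auto
    thus ?thesis
      using e by simp
  qed
  thus ?thesis
    by blast
qed

theorem theorem2p3:
  fixes v :: "complex \<Rightarrow> real" and z :: "nat \<Rightarrow> complex"
  assumes "typical_weight v"
    and "\<And>n. z n \<in> unit_disk"
    and "\<And>a. a \<in> c_zero \<Longrightarrow>
           \<exists>f\<in>bloch_space v. \<forall>n. of_real (v (z n)) * deriv f (z n) = a n"
  shows "interpolating_bloch v z"
  unfolding interpolating_bloch_def
proof
  have v: "weight v"
    using assms(1) by (simp add: typical_weight_def)
  have "\<exists>M. a \<in> weighted_traces v z M" if a: "a \<in> c_zero" for a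
  proof -
    obtain f where f: "f \<in> bloch_space v" "\<And>n. of_real (v (z n)) * deriv f (z n) = a n"
      using assms(3)[OF a] by blast
    obtain M where "deriv f \<in> weighted_ball v M"
      using deriv_bloch_in_weighted_ball[OF f(1)] .
    thus ?thesis
      using weighted_tracesI f(2) by blast
  qed
  then obtain C where
    C: "\<And>b. b \<in> c_zero \<Longrightarrow> (\<And>n. norm (b n) \<le> 1) \<Longrightarrow> b \<in> weighted_traces v z C"
    using weighted_traces_uniform[where v = v and z = z, OF v assms(2)] by blast
  fix a assume "a \<in> ell_infinity"
  then obtain B where B: "0 < B" "\<And>n. norm (a n) \<le> B"
    by (auto simp: ell_infinity_def Bseq_def)
  define trunc where "trunc = (\<lambda>j n. if n < j then of_real (1 / B) * a n else 0)"
  have "trunc j \<in> weighted_traces v z C" for j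
  proof (rule C)
    have "\<forall>\<^sub>F n in sequentially. trunc j n = 0"
      using eventually_ge_at_top[of j] by eventually_elim (simp add: trunc_def)
    thus "trunc j \<in> c_zero"
      by (simp add: c_zero_def tendsto_eventually)
    show "norm (trunc j n) \<le> 1" for n
      using B by (simp add: trunc_def norm_divide)
  qed
  moreover have "(\<lambda>j. trunc j n) \<longlonglongrightarrow> of_real (1 / B) * a n" for n
  proof (rule tendsto_eventually)
    show "\<forall>\<^sub>F j in sequentially. trunc j n = of_real (1 / B) * a n"
      using eventually_gt_at_top[of n] by eventually_elim (simp add: trunc_def)
  qed
  ultimately have "(\<lambda>n. of_real (1 / B) * a n) \<in> weighted_traces v z C"
    by (rule weighted_traces_limit[where z = z, OF v assms(2)])
  hence "(\<lambda>n. of_real B * (of_real (1 / B) * a n)) \<in> weighted_traces v z (B * C)"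
    using B(1) by (intro weighted_traces_scale) auto
  hence "a \<in> weighted_traces v z (B * C)"
    using B(1) by simp
  then obtain g where g: "g \<in> weighted_ball v (B * C)" "\<And>n. of_real (v (z n)) * g (z n) = a n"
    by (auto simp: weighted_traces_def)
  obtain f where f: "f \<in> bloch_space v" "\<And>x. x \<in> unit_disk \<Longrightarrow> deriv f x = g x"
    using primitive_in_bloch_space[OF g(1)] by blast
  have "of_real (v (z n)) * deriv f (z n) = a n" for n
    using g(2) f(2)[OF assms(2)] by metis
  with f(1) show "\<exists>f\<in>bloch_space v. \<forall>n. of_real (v (z n)) * deriv f (z n) = a n"
    by blast
qed

end
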